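(* Let $i\colon\mathsf{FinSet}\hookrightarrow\mathsf{Set}$ be the inclusion, and let $T$ be a consistent monad on $\mathsf{FinSet}$, i.e. one whose unit $\eta^T$ is monic. Then the pushforward monad $i_\#T$ on $\mathsf{Set}$ does not have rank.
   Context: The pushforward $i_\#T$ is the right Kan extension $(i_\#T,\varepsilon\colon(i_\#T)i\to iT)$ of $iT$ along $i$ (which always exists), with the unique monad structure such that $\varepsilon\cdot\eta^{i_\#T}i=i\eta^T$ and $\varepsilon\cdot\mu^{i_\#T}i=i\mu^T\cdot\varepsilon T\cdot(i_\#T)\varepsilon$. A monad on $\mathsf{Set}$ has rank if its underlying endofunctor is $\lambda$-accessible (preserves $\lambda$-filtered colimits) for some (infinite) regular cardinal $\lambda$. *)

theory Defs
  imports Main "HOL-Library.FuncSet"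
begin

unbundle cardinal_syntax

section \<open>Categories, functors, natural transformations\<close>

record ('o, 'a) cat =
  Obj :: "'o set"
  Arr :: "'a set"
  Dom :: "'a \<Rightarrow> 'o"
  Cod :: "'a \<Rightarrow> 'o"
  Idn :: "'o \<Rightarrow> 'a"
  Cmp :: "'a \<Rightarrow> 'a \<Rightarrow> 'a"   (* Cmp C g f is g after f *)

definition homset :: "('o, 'a) cat \<Rightarrow> 'o \<Rightarrow> 'o \<Rightarrow> 'a set" where
  "homset C x y = {f \<in> Arr C. Dom C f = x \<and> Cod C f = y}"

definition is_category :: "('o, 'a) cat \<Rightarrow> bool" where
  "is_category C \<longleftrightarrow>
     (\<forall>f\<in>Arr C. Dom C f \<in> Obj C \<and> Cod C f \<in> Obj C) \<and>
     (\<forall>x\<in>Obj C. Idn C x \<in> homset C x x) \<and>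
     (\<forall>f\<in>Arr C. \<forall>g\<in>Arr C. Dom C g = Cod C f \<longrightarrow> Cmp C g f \<in> homset C (Dom C f) (Cod C g)) \<and>
     (\<forall>f\<in>Arr C. Cmp C f (Idn C (Dom C f)) = f \<and> Cmp C (Idn C (Cod C f)) f = f) \<and>
     (\<forall>f\<in>Arr C. \<forall>g\<in>Arr C. \<forall>h\<in>Arr C. Dom C g = Cod C f \<longrightarrow> Dom C h = Cod C g \<longrightarrow>
        Cmp C h (Cmp C g f) = Cmp C (Cmp C h g) f)"

record ('o, 'a, 'p, 'b) func =
  fobj :: "'o \<Rightarrow> 'p"
  farr :: "'a \<Rightarrow> 'b"

definition is_functor :: "('o, 'a) cat \<Rightarrow> ('p, 'b) cat \<Rightarrow> ('o, 'a, 'p, 'b) func \<Rightarrow> bool" where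
  "is_functor C D F \<longleftrightarrow> is_category C \<and> is_category D \<and>
     (\<forall>x\<in>Obj C. fobj F x \<in> Obj D) \<and>
     (\<forall>f\<in>Arr C. farr F f \<in> homset D (fobj F (Dom C f)) (fobj F (Cod C f))) \<and>
     (\<forall>x\<in>Obj C. farr F (Idn C x) = Idn D (fobj F x)) \<and>
     (\<forall>f\<in>Arr C. \<forall>g\<in>Arr C. Dom C g = Cod C f \<longrightarrow>
        farr F (Cmp C g f) = Cmp D (farr F g) (farr F f))"

definition idF :: "('o, 'a, 'o, 'a) func" where
  "idF = \<lparr>fobj = (\<lambda>x. x), farr = (\<lambda>f. f)\<rparr>"

definition compF ::
  "('p, 'b, 'q, 'c) func \<Rightarrow> ('o, 'a, 'p, 'b) func \<Rightarrow> ('o, 'a, 'q, 'c) func"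
  (infixl "\<circ>F" 55) where
  "G \<circ>F F = \<lparr>fobj = (\<lambda>x. fobj G (fobj F x)), farr = (\<lambda>f. farr G (farr F f))\<rparr>"

text \<open>A natural transformation is given by its components; only their values on the objects
  of the source category are meaningful, so transformations are always compared objectwise there.\<close>

definition nat_trans ::
  "('o, 'a) cat \<Rightarrow> ('p, 'b) cat \<Rightarrow> ('o, 'a, 'p, 'b) func \<Rightarrow> ('o, 'a, 'p, 'b) func
    \<Rightarrow> ('o \<Rightarrow> 'b) \<Rightarrow> bool" where
  "nat_trans C D F G \<tau> \<longleftrightarrow> is_functor C D F \<and> is_functor C D G \<and>
     (\<forall>x\<in>Obj C. \<tau> x \<in> homset D (fobj F x) (fobj G x)) \<and>
     (\<forall>f\<in>Arr C. Cmp D (\<tau> (Cod C f)) (farr F f) = Cmp D (farr G f) (\<tau> (Dom C f)))"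

text \<open>Monomorphisms of the functor category from \<open>C\<close> to \<open>D\<close>.\<close>

definition monic_nat ::
  "('o, 'a) cat \<Rightarrow> ('p, 'b) cat \<Rightarrow> ('o, 'a, 'p, 'b) func \<Rightarrow> ('o, 'a, 'p, 'b) func
    \<Rightarrow> ('o \<Rightarrow> 'b) \<Rightarrow> bool" where
  "monic_nat C D F G \<tau> \<longleftrightarrow> nat_trans C D F G \<tau> \<and>
     (\<forall>H \<sigma> \<sigma>'. nat_trans C D H F \<sigma> \<longrightarrow> nat_trans C D H F \<sigma>' \<longrightarrow>
        (\<forall>x\<in>Obj C. Cmp D (\<tau> x) (\<sigma> x) = Cmp D (\<tau> x) (\<sigma>' x)) \<longrightarrow>
        (\<forall>x\<in>Obj C. \<sigma> x = \<sigma>' x))"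

section \<open>Monads\<close>

record ('o, 'a) monad =
  mfun :: "('o, 'a, 'o, 'a) func"
  munit :: "'o \<Rightarrow> 'a"
  mmult :: "'o \<Rightarrow> 'a"

definition is_monad :: "('o, 'a) cat \<Rightarrow> ('o, 'a) monad \<Rightarrow> bool" where
  "is_monad C T \<longleftrightarrow>
     is_functor C C (mfun T) \<and>
     nat_trans C C idF (mfun T) (munit T) \<and>
     nat_trans C C (mfun T \<circ>F mfun T) (mfun T) (mmult T) \<and>
     (\<forall>x\<in>Obj C.
        Cmp C (mmult T x) (munit T (fobj (mfun T) x)) = Idn C (fobj (mfun T) x) \<and>
        Cmp C (mmult T x) (farr (mfun T) (munit T x)) = Idn C (fobj (mfun T) x) \<and>
        Cmp C (mmult T x) (mmult T (fobj (mfun T) x)) =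
          Cmp C (mmult T x) (farr (mfun T) (mmult T x)))"

definition consistent_monad :: "('o, 'a) cat \<Rightarrow> ('o, 'a) monad \<Rightarrow> bool" where
  "consistent_monad C T \<longleftrightarrow> is_monad C T \<and> monic_nat C C idF (mfun T) (munit T)"

section \<open>Right Kan extensions and pushforward monads\<close>

text \<open>\<open>(R, \<epsilon>)\<close> is a right Kan extension of \<open>F : C \<rightarrow> E\<close> along \<open>K : C \<rightarrow> D\<close>,
  with \<open>\<epsilon> : R K \<rightarrow> F\<close>.\<close>

definition is_right_kan ::
  "('o, 'a) cat \<Rightarrow> ('p, 'b) cat \<Rightarrow> ('q, 'c) cat \<Rightarrow> ('o, 'a, 'p, 'b) func \<Rightarrow> ('o, 'a, 'q, 'c) func
    \<Rightarrow> ('p, 'b, 'q, 'c) func \<Rightarrow> ('o \<Rightarrow> 'c) \<Rightarrow> bool" where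
  "is_right_kan C D E K F R \<epsilon> \<longleftrightarrow>
     is_functor C D K \<and> is_functor D E R \<and> nat_trans C E (R \<circ>F K) F \<epsilon> \<and>
     (\<forall>G \<gamma>. is_functor D E G \<longrightarrow> nat_trans C E (G \<circ>F K) F \<gamma> \<longrightarrow>
        (\<exists>\<alpha>. nat_trans D E G R \<alpha> \<and>
             (\<forall>x\<in>Obj C. Cmp E (\<epsilon> x) (\<alpha> (fobj K x)) = \<gamma> x) \<and>
             (\<forall>\<beta>. nat_trans D E G R \<beta> \<longrightarrow>
                  (\<forall>x\<in>Obj C. Cmp E (\<epsilon> x) (\<beta> (fobj K x)) = \<gamma> x) \<longrightarrow>
                  (\<forall>y\<in>Obj D. \<beta> y = \<alpha> y))))"

text \<open>\<open>S\<close> with counit \<open>\<epsilon>\<close> is the pushforward along \<open>K : C \<rightarrow> D\<close> of the monad \<open>T\<close> on \<open>C\<close>: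
  the last two conjuncts are \<open>\<epsilon> \<cdot> \<eta>\<^sup>S K = K \<eta>\<^sup>T\<close> and
  \<open>\<epsilon> \<cdot> \<mu>\<^sup>S K = K \<mu>\<^sup>T \<cdot> \<epsilon> T \<cdot> S \<epsilon>\<close>.\<close>

definition is_pushforward ::
  "('o, 'a) cat \<Rightarrow> ('p, 'b) cat \<Rightarrow> ('o, 'a, 'p, 'b) func \<Rightarrow> ('o, 'a) monad
    \<Rightarrow> ('p, 'b) monad \<Rightarrow> ('o \<Rightarrow> 'b) \<Rightarrow> bool" where
  "is_pushforward C D K T S \<epsilon> \<longleftrightarrow>
     is_monad C T \<and> is_monad D S \<and>
     is_right_kan C D D K (K \<circ>F mfun T) (mfun S) \<epsilon> \<and>
     (\<forall>x\<in>Obj C. Cmp D (\<epsilon> x) (munit S (fobj K x)) = farr K (munit T x)) \<and>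
     (\<forall>x\<in>Obj C. Cmp D (\<epsilon> x) (mmult S (fobj K x)) =
        Cmp D (farr K (mmult T x)) (Cmp D (\<epsilon> (fobj (mfun T) x)) (farr (mfun S) (\<epsilon> x))))"

section \<open>The categories of sets and of finite sets\<close>

text \<open>HOL has no type of all sets, so \<open>Set\<close> is formed, as usual, inside a Grothendieck universe.
  The universe is a type whose cardinality is strongly inaccessible; its small sets are the
  subsets of strictly smaller cardinality, and every set of the universe is, up to bijection,
  one of these.\<close>

definition grothendieck_universe :: "'u itself \<Rightarrow> bool" where
  "grothendieck_universe _ \<longleftrightarrow>
     natLeq <o |UNIV :: 'u set| \<and>
     regularCard |UNIV :: 'u set| \<and>
     (\<forall>A :: 'u set. |A| <o |UNIV :: 'u set| \<longrightarrow> |Pow A| <o |UNIV :: 'u set| )"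

definition small :: "'u set \<Rightarrow> bool" where
  "small A \<longleftrightarrow> |A| <o |UNIV :: 'u set|"

type_synonym 'u fn = "'u set \<times> ('u \<Rightarrow> 'u) \<times> 'u set"

text \<open>The full category of sets on a given family of objects. An arrow is a triple
  (domain, function, codomain), the function being \<open>undefined\<close> outside the domain so that
  equality of arrows is equality of functions.\<close>

definition sets_cat :: "'u set set \<Rightarrow> ('u set, 'u fn) cat" where
  "sets_cat U =
     \<lparr>Obj = U,
      Arr = {(A, f, B). A \<in> U \<and> B \<in> U \<and> f \<in> A \<rightarrow>\<^sub>E B},
      Dom = (\<lambda>(A, f, B). A),
      Cod = (\<lambda>(A, f, B). B),
      Idn = (\<lambda>A. (A, restrict (\<lambda>x. x) A, A)),
      Cmp = (\<lambda>(B', g, C) (A, f, B). (A, compose A g f, C))\<rparr>"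

definition SetC :: "('u set, 'u fn) cat" where
  "SetC = sets_cat {A. small A}"

definition FinSet :: "('u set, 'u fn) cat" where
  "FinSet = sets_cat {A. finite A}"

definition incl :: "('u set, 'u fn, 'u set, 'u fn) func" where
  "incl = \<lparr>fobj = (\<lambda>A. A), farr = (\<lambda>f. f)\<rparr>"

section \<open>Filtered colimits and rank\<close>

definition is_cocone ::
  "('j, 'k) cat \<Rightarrow> ('o, 'a) cat \<Rightarrow> ('j, 'k, 'o, 'a) func \<Rightarrow> 'o \<Rightarrow> ('j \<Rightarrow> 'a) \<Rightarrow> bool" where
  "is_cocone J C D c \<iota> \<longleftrightarrow>
     is_functor J C D \<and> c \<in> Obj C \<and>
     (\<forall>j\<in>Obj J. \<iota> j \<in> homset C (fobj D j) c) \<and>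
     (\<forall>u\<in>Arr J. Cmp C (\<iota> (Cod J u)) (farr D u) = \<iota> (Dom J u))"

definition is_colimit ::
  "('j, 'k) cat \<Rightarrow> ('o, 'a) cat \<Rightarrow> ('j, 'k, 'o, 'a) func \<Rightarrow> 'o \<Rightarrow> ('j \<Rightarrow> 'a) \<Rightarrow> bool" where
  "is_colimit J C D c \<iota> \<longleftrightarrow>
     is_cocone J C D c \<iota> \<and>
     (\<forall>d \<kappa>. is_cocone J C D d \<kappa> \<longrightarrow>
        (\<exists>!h. h \<in> homset C c d \<and> (\<forall>j\<in>Obj J. Cmp C h (\<iota> j) = \<kappa> j)))"

text \<open>Categories with objects and arrows in the universe \<open>'u\<close>; up to isomorphism these are
  all small categories.\<close>

definition small_category :: "('u, 'u) cat \<Rightarrow> bool" where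
  "small_category J \<longleftrightarrow> is_category J \<and> small (Obj J) \<and> small (Arr J)"

definition small_regular_cardinal :: "'u rel \<Rightarrow> bool" where
  "small_regular_cardinal l \<longleftrightarrow>
     Card_order l \<and> \<not> finite (Field l) \<and> regularCard l \<and> l <o |UNIV :: 'u set|"

text \<open>\<open>J\<close> is \<open>\<lambda>\<close>-filtered: every diagram in \<open>J\<close> with fewer than \<open>\<lambda>\<close> arrows has a cocone.
  (It is essential that diagrams need not be injective.)\<close>

definition filtered :: "'u rel \<Rightarrow> ('u, 'u) cat \<Rightarrow> bool" where
  "filtered l J \<longleftrightarrow> is_category J \<and>
     (\<forall>(K :: ('u, 'u) cat) D. is_functor K J D \<longrightarrow> |Arr K| <o l \<longrightarrow>
        (\<exists>c \<iota>. is_cocone K J D c \<iota>))"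

definition accessible_functor ::
  "'u rel \<Rightarrow> ('o, 'a) cat \<Rightarrow> ('p, 'b) cat \<Rightarrow> ('o, 'a, 'p, 'b) func \<Rightarrow> bool" where
  "accessible_functor l C E F \<longleftrightarrow> is_functor C E F \<and>
     (\<forall>(J :: ('u, 'u) cat) D c \<iota>. small_category J \<longrightarrow> filtered l J \<longrightarrow> is_colimit J C D c \<iota> \<longrightarrow>
        is_colimit J E (F \<circ>F D) (fobj F c) (\<lambda>j. farr F (\<iota> j)))"

definition has_rank :: "('u set, 'u fn) monad \<Rightarrow> bool" where
  "has_rank S \<longleftrightarrow>
     (\<exists>l :: 'u rel. small_regular_cardinal l \<and> accessible_functor l SetC SetC (mfun S))"

end

theory Submission
  imports Defs
begin

text \<open>Let \<open>\<lambda>\<close> be a small regular cardinal, \<open>X\<close> a set well-ordered in type \<open>\<lambda>\<close>, and \<open>F\<close> an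
  ultrafilter on \<open>X\<close> containing no proper initial segment. The maps
  \<open>f \<mapsto> \<eta>\<^sub>Y (lim\<^sub>F f)\<close>, for \<open>f : X \<rightarrow> Y\<close> with \<open>Y\<close> finite, are natural in \<open>Y\<close>, so the
  universal property of the right Kan extension, applied to the representable functor of \<open>X\<close>,
  yields by Yoneda an element \<open>s\<close> of \<open>S X\<close> with \<open>\<epsilon>\<^sub>Y (S f s) = \<eta>\<^sub>Y (lim\<^sub>F f)\<close>. The set \<open>X\<close> is the
  \<open>\<lambda>\<close>-filtered colimit of its proper initial segments; if \<open>S\<close> preserved it, then \<open>s\<close> would come
  from some initial segment \<open>A\<close>. A two-valued map that is constant on \<open>A\<close> and takes the other
  value off \<open>A\<close>, and the constant map agreeing with it on \<open>A\<close>, would then have the same image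
  under \<open>f \<mapsto> \<eta> (lim\<^sub>F f)\<close>, although their limits along \<open>F\<close> differ: \<open>\<eta>\<close> is not injective.\<close>

section \<open>Ultrafilters\<close>

text \<open>Smaller filters are finer, so Zorn's lemma is applied to the proper filters below
  \<open>F\<close> under the reversed order and gives a finest one, \<open>G\<close>. Restricting
  \<open>G\<close> to the set where \<open>P\<close> holds either makes it improper, and then the
  negation of \<open>P\<close> holds eventually, or leaves it unchanged, and then \<open>P\<close>
  does.\<close>

lemma exists_ultrafilter_le:
  fixes F :: "'a filter"
  assumes "F \<noteq> bot"
  obtains G where "G \<le> F" "G \<noteq> bot"
    "\<And>P. eventually P G \<or> eventually (\<lambda>x. \<not> P x) G"
proof -
  define A where "A = {G. G \<le> F \<and> G \<noteq> bot}"
  have FA: "F \<in> A"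
    using assms by (simp add: A_def)
  have "\<exists>m\<in>A. \<forall>a\<in>A. m \<ge> a \<longrightarrow> a = m"
  proof (rule predicate_Zorn)
    show "partial_order_on A (relation_of (\<ge>) A)"
      by (rule partial_order_on_relation_ofI) auto
    fix C assume C: "C \<in> Chains (relation_of (\<ge>) A)"
    then have CA: "C \<subseteq> A" and lin: "\<And>G H. G \<in> C \<Longrightarrow> H \<in> C \<Longrightarrow> G \<ge> H \<or> H \<ge> G"
      unfolding Chains_def relation_of_def by auto
    show "\<exists>u\<in>A. \<forall>a\<in>C. a \<ge> u"
    proof (cases "C = {}")
      case True
      then show ?thesis using FA by auto
    next
      case False
      \<comment> \<open>A chain is a filter base, so a property eventual in its infimum is already
        eventual in a member; hence the infimum of proper filters in the chain stays proper.\<close>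
      have "eventually P (Inf C) \<longleftrightarrow> (\<exists>G\<in>C. eventually P G)" for P
      proof (rule eventually_Inf_base[OF False])
        fix G H assume "G \<in> C" "H \<in> C"
        then show "\<exists>x\<in>C. x \<le> inf G H" using lin[of G H] by auto
      qed
      then have "Inf C \<noteq> bot"
        using CA by (auto simp: trivial_limit_def A_def)
      moreover have "Inf C \<le> F"
        using False CA by (auto simp: A_def intro: Inf_lower2)
      ultimately show ?thesis by (auto simp: A_def Inf_lower)
    qed
  qed
  then obtain G where G: "G \<in> A" and min: "\<And>H. H \<in> A \<Longrightarrow> H \<le> G \<Longrightarrow> H = G"
    by auto
  have "eventually P G \<or> eventually (\<lambda>x. \<not> P x) G" for P
  proof (cases "inf G (principal {x. P x}) = bot")
    case True
    then show ?thesis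
      by (auto simp: trivial_limit_def eventually_inf_principal)
  next
    case False
    then have "inf G (principal {x. P x}) = G"
      using G by (intro min) (auto simp: A_def le_infI1)
    then have "eventually P G \<longleftrightarrow> eventually P (inf G (principal {x. P x}))"
      by (simp only:)
    also have "\<dots>" by (simp add: eventually_inf_principal)
    finally show ?thesis ..
  qed
  with G show thesis
    by (intro that[of G]) (auto simp: A_def)
qed

text \<open>The limit of \<open>f\<close> along \<open>F\<close> in the discrete topology. The
  description is meaningful only when \<open>f\<close> is eventually constant along a proper
  \<open>F\<close>.\<close>

definition ultra_lim :: "'a filter \<Rightarrow> ('a \<Rightarrow> 'b) \<Rightarrow> 'b" where
  "ultra_lim F f = (THE y. eventually (\<lambda>x. f x = y) F)"

lemma ultra_lim_eqI:
  assumes "F \<noteq> bot" "eventually (\<lambda>x. f x = y) F"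
  shows "ultra_lim F f = y"
  unfolding ultra_lim_def
proof (rule the_equality)
  fix z assume "eventually (\<lambda>x. f x = z) F"
  with assms(2) have "eventually (\<lambda>x. y = z) F"
    by eventually_elim auto
  with assms(1) show "z = y"
    by (auto simp: eventually_const_iff)
qed (rule assms)

text \<open>Compactness of a finite discrete space: an ultrafilter that selected no value in
  \<open>Y\<close> would eventually avoid each of them, hence by finiteness all of them at once,
  contradicting properness.\<close>

lemma ultra_lim_finite:
  assumes F: "F \<noteq> bot" "\<And>P. eventually P F \<or> eventually (\<lambda>x. \<not> P x) F"
    and fin: "finite Y" and ev: "eventually (\<lambda>x. f x \<in> Y) F"
  shows "ultra_lim F f \<in> Y" "eventually (\<lambda>x. f x = ultra_lim F f) F"
proof -
  have "\<exists>y\<in>Y. eventually (\<lambda>x. f x = y) F"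
  proof (rule ccontr)
    assume "\<not> ?thesis"
    then have "\<forall>y\<in>Y. eventually (\<lambda>x. f x \<noteq> y) F" using F(2) by blast
    then have "eventually (\<lambda>x. \<forall>y\<in>Y. f x \<noteq> y) F"
      by (rule eventually_ball_finite[OF fin])
    with ev have "eventually (\<lambda>x. False) F" by eventually_elim auto
    with F(1) show False by simp
  qed
  then obtain y where y: "y \<in> Y" "eventually (\<lambda>x. f x = y) F" by blast
  have "ultra_lim F f = y" by (rule ultra_lim_eqI[OF F(1) y(2)])
  with y show "ultra_lim F f \<in> Y" "eventually (\<lambda>x. f x = ultra_lim F f) F" by auto
qed

section \<open>Categories of sets\<close>

lemma functor_farr:
  "is_functor C D F \<Longrightarrow> \<phi> \<in> Arr C \<Longrightarrow>
    farr F \<phi> \<in> homset D (fobj F (Dom C \<phi>)) (fobj F (Cod C \<phi>))"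
  by (simp add: is_functor_def)

lemma functor_Cmp:
  "is_functor C D F \<Longrightarrow> \<phi> \<in> Arr C \<Longrightarrow> \<psi> \<in> Arr C \<Longrightarrow> Dom C \<psi> = Cod C \<phi> \<Longrightarrow>
    farr F (Cmp C \<psi> \<phi>) = Cmp D (farr F \<psi>) (farr F \<phi>)"
  by (simp add: is_functor_def)

lemma nat_trans_natural:
  "nat_trans C D F G \<tau> \<Longrightarrow> \<phi> \<in> Arr C \<Longrightarrow>
    Cmp D (\<tau> (Cod C \<phi>)) (farr F \<phi>) = Cmp D (farr G \<phi>) (\<tau> (Dom C \<phi>))"
  by (simp add: nat_trans_def)

abbreviation app :: "'u fn \<Rightarrow> 'u \<Rightarrow> 'u" where
  "app \<phi> \<equiv> fst (snd \<phi>)"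

lemma sets_cat_simps [simp]:
  "Obj (sets_cat U) = U"
  "Dom (sets_cat U) \<phi> = fst \<phi>"
  "Cod (sets_cat U) \<phi> = snd (snd \<phi>)"
  "Idn (sets_cat U) A = (A, restrict (\<lambda>x. x) A, A)"
  "Cmp (sets_cat U) \<psi> \<phi> = (fst \<phi>, compose (fst \<phi>) (app \<psi>) (app \<phi>), snd (snd \<psi>))"
  "(A, f, B) \<in> Arr (sets_cat U) \<longleftrightarrow> A \<in> U \<and> B \<in> U \<and> f \<in> A \<rightarrow>\<^sub>E B"
  by (auto simp: sets_cat_def split: prod.splits)

lemma homset_sets_cat:
  "\<phi> \<in> homset (sets_cat U) A B \<longleftrightarrow>
     A \<in> U \<and> B \<in> U \<and> fst \<phi> = A \<and> app \<phi> \<in> A \<rightarrow>\<^sub>E B \<and> snd (snd \<phi>) = B"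
  by (cases \<phi>) (auto simp: homset_def)

lemma Arr_sets_cat:
  "\<phi> \<in> Arr (sets_cat U) \<longleftrightarrow>
     fst \<phi> \<in> U \<and> snd (snd \<phi>) \<in> U \<and> app \<phi> \<in> fst \<phi> \<rightarrow>\<^sub>E snd (snd \<phi>)"
  by (cases \<phi>) auto

lemma compose_in_PiE:
  assumes "f \<in> A \<rightarrow>\<^sub>E B" "g \<in> B \<rightarrow>\<^sub>E C"
  shows "compose A g f \<in> A \<rightarrow>\<^sub>E C"
  using assms by (auto simp: compose_def)

lemma sets_cat_eqI:
  assumes "\<phi> \<in> homset (sets_cat U) A B" "\<psi> \<in> homset (sets_cat U) A B"
    and "\<And>x. x \<in> A \<Longrightarrow> app \<phi> x = app \<psi> x"
  shows "\<phi> = \<psi>"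
  using assms PiE_ext[of "app \<phi>" A "\<lambda>_. B" "app \<psi>"]
  by (simp add: homset_sets_cat prod_eq_iff)

lemma app_Cmp: "x \<in> fst \<phi> \<Longrightarrow> app (Cmp (sets_cat U) \<psi> \<phi>) x = app \<psi> (app \<phi> x)"
  by (simp add: compose_def)

lemma Cmp_in_homset:
  assumes "\<phi> \<in> homset (sets_cat U) A B" "\<psi> \<in> homset (sets_cat U) B C"
  shows "Cmp (sets_cat U) \<psi> \<phi> \<in> homset (sets_cat U) A C"
  using assms compose_in_PiE[of "app \<phi>" A B "app \<psi>" C] by (simp add: homset_sets_cat)

lemma compose_restrict_id_right:
  "f \<in> A \<rightarrow>\<^sub>E B \<Longrightarrow> compose A f (restrict (\<lambda>x. x) A) = f"
  by (rule compose_Id) (auto simp: PiE_def)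

lemma compose_restrict_id_left:
  "f \<in> A \<rightarrow>\<^sub>E B \<Longrightarrow> compose A (restrict (\<lambda>x. x) B) f = f"
  by (rule Id_compose) (auto simp: PiE_def)

lemma is_category_sets_cat: "is_category (sets_cat U)"
  unfolding is_category_def
proof (intro conjI ballI impI)
  fix \<phi> \<psi> assume "\<phi> \<in> Arr (sets_cat U)" "\<psi> \<in> Arr (sets_cat U)" "Dom (sets_cat U) \<psi> = Cod (sets_cat U) \<phi>"
  then show "Cmp (sets_cat U) \<psi> \<phi> \<in> homset (sets_cat U) (Dom (sets_cat U) \<phi>) (Cod (sets_cat U) \<psi>)"
    by (intro Cmp_in_homset[of _ _ _ "fst \<psi>"]) (auto simp: homset_sets_cat Arr_sets_cat)
next
  fix \<phi> \<psi> \<chi> assume "\<phi> \<in> Arr (sets_cat U)" "Dom (sets_cat U) \<psi> = Cod (sets_cat U) \<phi>"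
  then show "Cmp (sets_cat U) \<chi> (Cmp (sets_cat U) \<psi> \<phi>) = Cmp (sets_cat U) (Cmp (sets_cat U) \<chi> \<psi>) \<phi>"
    by (auto simp: Arr_sets_cat compose_def fun_eq_iff)
qed (auto simp: homset_sets_cat Arr_sets_cat compose_restrict_id_left compose_restrict_id_right
      prod_eq_iff)

lemma SetC_eq: "SetC = sets_cat (Collect small)"
  by (simp add: SetC_def)

lemma FinSet_eq: "FinSet = sets_cat (Collect finite)"
  by (simp add: FinSet_def)

section \<open>Functors and transformations between categories of sets, read elementwise\<close>

lemma functor_sets_catD:
  assumes "is_functor (sets_cat U) (sets_cat V) F" "A \<in> U" "B \<in> U" "f \<in> A \<rightarrow>\<^sub>E B"
  shows "fobj F A \<in> V" "fobj F B \<in> V" "fst (farr F (A, f, B)) = fobj F A"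
    "snd (snd (farr F (A, f, B))) = fobj F B"
    "app (farr F (A, f, B)) \<in> fobj F A \<rightarrow>\<^sub>E fobj F B"
proof -
  have "(A, f, B) \<in> Arr (sets_cat U)" using assms by simp
  then have "farr F (A, f, B) \<in> homset (sets_cat V) (fobj F A) (fobj F B)"
    using functor_farr[OF assms(1)] by fastforce
  then show "fobj F A \<in> V" "fobj F B \<in> V" "fst (farr F (A, f, B)) = fobj F A"
    "snd (snd (farr F (A, f, B))) = fobj F B"
    "app (farr F (A, f, B)) \<in> fobj F A \<rightarrow>\<^sub>E fobj F B"
    by (auto simp: homset_sets_cat)
qed

lemma functor_sets_cat_comp:
  assumes "is_functor (sets_cat U) (sets_cat V) F" "A \<in> U" "B \<in> U" "C \<in> U"
    and "f \<in> A \<rightarrow>\<^sub>E B" "g \<in> B \<rightarrow>\<^sub>E C" "x \<in> fobj F A"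
  shows "app (farr F (A, compose A g f, C)) x = app (farr F (B, g, C)) (app (farr F (A, f, B)) x)"
proof -
  have "(A, f, B) \<in> Arr (sets_cat U)" "(B, g, C) \<in> Arr (sets_cat U)" using assms by auto
  then have "farr F (Cmp (sets_cat U) (B, g, C) (A, f, B)) =
      Cmp (sets_cat V) (farr F (B, g, C)) (farr F (A, f, B))"
    using functor_Cmp[OF assms(1)] by (simp del: sets_cat_simps(5))
  then show ?thesis
    using functor_sets_catD[OF assms(1,2,3,5)] assms(7) by (simp add: compose_def)
qed

lemma nat_trans_sets_cat_in:
  assumes "nat_trans (sets_cat U) (sets_cat V) F G \<tau>" "A \<in> U"
  shows "fst (\<tau> A) = fobj F A" "app (\<tau> A) \<in> fobj F A \<rightarrow>\<^sub>E fobj G A" "snd (snd (\<tau> A)) = fobj G A"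
  using assms by (auto simp: nat_trans_def homset_sets_cat)

lemma nat_trans_sets_cat_natural:
  assumes "nat_trans (sets_cat U) (sets_cat V) F G \<tau>" "A \<in> U" "B \<in> U" "f \<in> A \<rightarrow>\<^sub>E B"
    and "x \<in> fobj F A"
  shows "app (\<tau> B) (app (farr F (A, f, B)) x) = app (farr G (A, f, B)) (app (\<tau> A) x)"
proof -
  have F: "is_functor (sets_cat U) (sets_cat V) F" using assms(1) by (simp add: nat_trans_def)
  have "(A, f, B) \<in> Arr (sets_cat U)" using assms by simp
  then have eq: "Cmp (sets_cat V) (\<tau> B) (farr F (A, f, B)) = Cmp (sets_cat V) (farr G (A, f, B)) (\<tau> A)"
    using nat_trans_natural[OF assms(1)] by fastforce
  have dom: "x \<in> fst (farr F (A, f, B))" "x \<in> fst (\<tau> A)"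
    using functor_sets_catD(3)[OF F assms(2-4)] nat_trans_sets_cat_in(1)[OF assms(1,2)] assms(5)
    by simp_all
  show ?thesis
    using arg_cong[OF eq, of "\<lambda>\<phi>. app \<phi> x"] unfolding app_Cmp[OF dom(1)] app_Cmp[OF dom(2)] .
qed

section \<open>Representable functors\<close>

text \<open>Objects of \<open>sets_cat U\<close> are sets of elements of \<open>'u\<close>, so the hom-set of maps from \<open>X\<close> to
  \<open>Y\<close> has to be encoded; \<open>c Y\<close> is any injective encoding.\<close>

definition repF :: "'u set \<Rightarrow> ('u set \<Rightarrow> ('u \<Rightarrow> 'u) \<Rightarrow> 'u) \<Rightarrow> ('u set, 'u fn, 'u set, 'u fn) func"
  where
  "repF X c =
     \<lparr>fobj = (\<lambda>Y. c Y ` (X \<rightarrow>\<^sub>E Y)),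
      farr = (\<lambda>(A, g, B). (c A ` (X \<rightarrow>\<^sub>E A),
        restrict (\<lambda>z. c B (compose X g (inv_into (X \<rightarrow>\<^sub>E A) (c A) z))) (c A ` (X \<rightarrow>\<^sub>E A)),
        c B ` (X \<rightarrow>\<^sub>E B)))\<rparr>"

lemma fobj_repF [simp]: "fobj (repF X c) Y = c Y ` (X \<rightarrow>\<^sub>E Y)"
  by (simp add: repF_def)

lemma app_farr_repF:
  assumes "inj_on (c A) (X \<rightarrow>\<^sub>E A)" "f \<in> X \<rightarrow>\<^sub>E A"
  shows "app (farr (repF X c) (A, g, B)) (c A f) = c B (compose X g f)"
  using assms by (simp add: repF_def)

lemma farr_repF_in:
  assumes UV: "\<And>Y. Y \<in> U \<Longrightarrow> inj_on (c Y) (X \<rightarrow>\<^sub>E Y)" "\<And>Y. Y \<in> U \<Longrightarrow> c Y ` (X \<rightarrow>\<^sub>E Y) \<in> V"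
    and "A \<in> U" "B \<in> U" "g \<in> A \<rightarrow>\<^sub>E B"
  shows "farr (repF X c) (A, g, B) \<in> homset (sets_cat V) (fobj (repF X c) A) (fobj (repF X c) B)"
proof -
  have "app (farr (repF X c) (A, g, B)) z \<in> c B ` (X \<rightarrow>\<^sub>E B)" if "z \<in> c A ` (X \<rightarrow>\<^sub>E A)" for z
  proof -
    from that obtain f where f: "f \<in> X \<rightarrow>\<^sub>E A" "z = c A f" by blast
    show ?thesis
      unfolding f(2) app_farr_repF[of c A X f g B, OF UV(1)[OF assms(3)] f(1)]
      by (intro imageI compose_in_PiE[OF f(1) assms(5)])
  qed
  moreover have "app (farr (repF X c) (A, g, B)) \<in> extensional (c A ` (X \<rightarrow>\<^sub>E A))"
    by (simp add: repF_def)
  ultimately have "app (farr (repF X c) (A, g, B)) \<in> c A ` (X \<rightarrow>\<^sub>E A) \<rightarrow>\<^sub>E c B ` (X \<rightarrow>\<^sub>E B)"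
    by (simp add: PiE_def Pi_def)
  then show ?thesis
    using assms(3,4) UV(2) by (simp add: homset_sets_cat) (simp add: repF_def)
qed

text \<open>The families \<open>U\<close> and \<open>V\<close> are kept separate because the
  representable serves on \<open>FinSet\<close>, on \<open>SetC\<close>, and as a functor from the
  finite to the small sets.\<close>

lemma is_functor_repF:
  assumes UV: "\<And>Y. Y \<in> U \<Longrightarrow> inj_on (c Y) (X \<rightarrow>\<^sub>E Y)" "\<And>Y. Y \<in> U \<Longrightarrow> c Y ` (X \<rightarrow>\<^sub>E Y) \<in> V"
  shows "is_functor (sets_cat U) (sets_cat V) (repF X c)"
proof -
  have in_hom: "farr (repF X c) (A, g, B) \<in> homset (sets_cat V) (fobj (repF X c) A) (fobj (repF X c) B)"
    if "A \<in> U" "B \<in> U" "g \<in> A \<rightarrow>\<^sub>E B" for A B g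
    by (rule farr_repF_in[of U]) (fact UV that)+
  have 1: "farr (repF X c) \<phi> \<in> homset (sets_cat V) (fobj (repF X c) (fst \<phi>))
      (fobj (repF X c) (snd (snd \<phi>)))" if "\<phi> \<in> Arr (sets_cat U)" for \<phi>
    using in_hom[of "fst \<phi>" "snd (snd \<phi>)" "app \<phi>"] that by (simp add: Arr_sets_cat)
  have 2: "farr (repF X c) (Idn (sets_cat U) A) = Idn (sets_cat V) (fobj (repF X c) A)"
    if "A \<in> U" for A
  proof (rule sets_cat_eqI)
    show "farr (repF X c) (Idn (sets_cat U) A) \<in> homset (sets_cat V) (fobj (repF X c) A) (fobj (repF X c) A)"
      using in_hom[OF that that, of "restrict (\<lambda>x. x) A"] by simp
    show "Idn (sets_cat V) (fobj (repF X c) A) \<in> homset (sets_cat V) (fobj (repF X c) A) (fobj (repF X c) A)"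
      using is_category_sets_cat[of V] UV(2)[OF that] unfolding is_category_def by simp
    fix z assume "z \<in> fobj (repF X c) A"
    then obtain f where f: "f \<in> X \<rightarrow>\<^sub>E A" "z = c A f" by auto
    then show "app (farr (repF X c) (Idn (sets_cat U) A)) z = app (Idn (sets_cat V) (fobj (repF X c) A)) z"
      by (simp add: app_farr_repF UV(1)[OF that] compose_restrict_id_left)
  qed
  have 3: "farr (repF X c) (Cmp (sets_cat U) \<psi> \<phi>) =
      Cmp (sets_cat V) (farr (repF X c) \<psi>) (farr (repF X c) \<phi>)"
    if \<phi>\<psi>: "\<phi> \<in> Arr (sets_cat U)" "\<psi> \<in> Arr (sets_cat U)" "fst \<psi> = snd (snd \<phi>)" for \<phi> \<psi>
  proof -
    obtain A f B where \<phi>: "\<phi> = (A, f, B)" by (cases \<phi>)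
    obtain g C where \<psi>: "\<psi> = (B, g, C)" using \<phi>\<psi>(3) \<phi> by (cases \<psi>) auto
    have U: "A \<in> U" "B \<in> U" "C \<in> U" "f \<in> A \<rightarrow>\<^sub>E B" "g \<in> B \<rightarrow>\<^sub>E C"
      using \<phi>\<psi> by (simp_all add: \<phi> \<psi>)
    show ?thesis
    proof (rule sets_cat_eqI)
      show "farr (repF X c) (Cmp (sets_cat U) \<psi> \<phi>) \<in>
          homset (sets_cat V) (fobj (repF X c) A) (fobj (repF X c) C)"
        using in_hom[OF U(1,3) compose_in_PiE[OF U(4,5)]] by (simp add: \<phi> \<psi>)
      show "Cmp (sets_cat V) (farr (repF X c) \<psi>) (farr (repF X c) \<phi>) \<in>
          homset (sets_cat V) (fobj (repF X c) A) (fobj (repF X c) C)"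
        unfolding \<phi> \<psi> by (rule Cmp_in_homset[OF in_hom[OF U(1,2,4)] in_hom[OF U(2,3,5)]])
      fix z assume "z \<in> fobj (repF X c) A"
      then obtain h where h: "h \<in> X \<rightarrow>\<^sub>E A" "z = c A h" by auto
      have dom: "z \<in> fst (farr (repF X c) (A, f, B))" using h by (simp add: repF_def)
      have "compose X (compose A g f) h = compose X g (compose X f h)"
        using h(1) by (auto simp: compose_def fun_eq_iff)
      then show "app (farr (repF X c) (Cmp (sets_cat U) \<psi> \<phi>)) z =
          app (Cmp (sets_cat V) (farr (repF X c) \<psi>) (farr (repF X c) \<phi>)) z"
        unfolding \<phi> \<psi> app_Cmp[OF dom]
        using h UV(1) U compose_in_PiE[OF h(1) U(4)] by (simp add: app_farr_repF)
    qed
  qed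
  show ?thesis
    unfolding is_functor_def
  proof (intro conjI ballI impI)
    show "fobj (repF X c) A \<in> Obj (sets_cat V)" if "A \<in> Obj (sets_cat U)" for A
      using that UV(2) by simp
  qed (use 1 2 3 in \<open>simp_all add: is_category_sets_cat del: fobj_repF sets_cat_simps(4,5)\<close>)
qed

text \<open>The transformation from the representable of \<open>X\<close> to \<open>F\<close> whose
  components, before encoding, are \<open>\<theta> Y\<close>: a code is first turned back into the
  map it stands for.\<close>

definition repT :: "'u set \<Rightarrow> ('u set \<Rightarrow> ('u \<Rightarrow> 'u) \<Rightarrow> 'u) \<Rightarrow> ('u set, 'u fn, 'u set, 'u fn) func
    \<Rightarrow> ('u set \<Rightarrow> ('u \<Rightarrow> 'u) \<Rightarrow> 'u) \<Rightarrow> 'u set \<Rightarrow> 'u fn" where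
  "repT X c F \<theta> Y = (c Y ` (X \<rightarrow>\<^sub>E Y),
     restrict (\<lambda>z. \<theta> Y (inv_into (X \<rightarrow>\<^sub>E Y) (c Y) z)) (c Y ` (X \<rightarrow>\<^sub>E Y)), fobj F Y)"

lemma app_repT:
  assumes "inj_on (c Y) (X \<rightarrow>\<^sub>E Y)" "f \<in> X \<rightarrow>\<^sub>E Y"
  shows "app (repT X c F \<theta> Y) (c Y f) = \<theta> Y f"
  using assms by (simp add: repT_def)

text \<open>Every element of the encoded hom-set is a code \<open>c A h\<close>, so the naturality
  squares reduce to the unencoded identity \<open>nat\<close>.\<close>

lemma nat_trans_repT:
  assumes UV: "\<And>Y. Y \<in> U \<Longrightarrow> inj_on (c Y) (X \<rightarrow>\<^sub>E Y)" "\<And>Y. Y \<in> U \<Longrightarrow> c Y ` (X \<rightarrow>\<^sub>E Y) \<in> V"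
    and F: "is_functor (sets_cat U) (sets_cat V) F"
    and \<theta>: "\<And>Y f. Y \<in> U \<Longrightarrow> f \<in> X \<rightarrow>\<^sub>E Y \<Longrightarrow> \<theta> Y f \<in> fobj F Y"
    and nat: "\<And>A B f g. A \<in> U \<Longrightarrow> B \<in> U \<Longrightarrow> f \<in> X \<rightarrow>\<^sub>E A \<Longrightarrow> g \<in> A \<rightarrow>\<^sub>E B \<Longrightarrow>
        \<theta> B (compose X g f) = app (farr F (A, g, B)) (\<theta> A f)"
  shows "nat_trans (sets_cat U) (sets_cat V) (repF X c) F (repT X c F \<theta>)"
proof -
  have R: "is_functor (sets_cat U) (sets_cat V) (repF X c)"
    by (rule is_functor_repF) (fact UV)+
  have FV: "fobj F Y \<in> V" if "Y \<in> U" for Y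
    using F that by (simp add: is_functor_def)
  have 1: "repT X c F \<theta> Y \<in> homset (sets_cat V) (fobj (repF X c) Y) (fobj F Y)" if "Y \<in> U" for Y
  proof -
    have "app (repT X c F \<theta> Y) \<in> c Y ` (X \<rightarrow>\<^sub>E Y) \<rightarrow>\<^sub>E fobj F Y"
    proof
      fix z assume "z \<in> c Y ` (X \<rightarrow>\<^sub>E Y)"
      then show "app (repT X c F \<theta> Y) z \<in> fobj F Y"
        using app_repT[where c = c, OF UV(1)[OF that]] \<theta>[OF that] by force
    qed (simp add: repT_def)
    then show ?thesis
      using FV[OF that] UV(2)[OF that] by (simp add: homset_sets_cat) (simp add: repT_def)
  qed
  have 2: "Cmp (sets_cat V) (repT X c F \<theta> B) (farr (repF X c) (A, g, B)) =
      Cmp (sets_cat V) (farr F (A, g, B)) (repT X c F \<theta> A)"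
    if U: "A \<in> U" "B \<in> U" "g \<in> A \<rightarrow>\<^sub>E B" for A B g
  proof (rule sets_cat_eqI)
    have r: "farr (repF X c) (A, g, B) \<in> homset (sets_cat V) (fobj (repF X c) A) (fobj (repF X c) B)"
      by (rule farr_repF_in[of U]) (fact UV U)+
    show "Cmp (sets_cat V) (repT X c F \<theta> B) (farr (repF X c) (A, g, B)) \<in>
        homset (sets_cat V) (fobj (repF X c) A) (fobj F B)"
      by (rule Cmp_in_homset[OF r 1[OF U(2)]])
    have "farr F (A, g, B) \<in> homset (sets_cat V) (fobj F A) (fobj F B)"
      using functor_sets_catD[OF F U] by (simp add: homset_sets_cat)
    then show "Cmp (sets_cat V) (farr F (A, g, B)) (repT X c F \<theta> A) \<in>
        homset (sets_cat V) (fobj (repF X c) A) (fobj F B)"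
      by (rule Cmp_in_homset[OF 1[OF U(1)]])
    fix z assume z: "z \<in> fobj (repF X c) A"
    then obtain h where h: "h \<in> X \<rightarrow>\<^sub>E A" "z = c A h" by auto
    have dom: "z \<in> fst (farr (repF X c) (A, g, B))" "z \<in> fst (repT X c F \<theta> A)"
      using z by (simp_all add: repF_def repT_def)
    show "app (Cmp (sets_cat V) (repT X c F \<theta> B) (farr (repF X c) (A, g, B))) z =
        app (Cmp (sets_cat V) (farr F (A, g, B)) (repT X c F \<theta> A)) z"
      unfolding app_Cmp[OF dom(1)] app_Cmp[OF dom(2)] unfolding h(2)
      using app_farr_repF[where c = c, OF UV(1)[OF U(1)] h(1)] app_repT[where c = c, OF UV(1)[OF U(1)] h(1)]
        app_repT[where c = c, OF UV(1)[OF U(2)] compose_in_PiE[OF h(1) U(3)]] nat[OF U(1,2) h(1) U(3)]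
      by simp
  qed
  show ?thesis
    unfolding nat_trans_def
  proof (intro conjI ballI R F)
    fix \<phi> assume "\<phi> \<in> Arr (sets_cat U)"
    then show "Cmp (sets_cat V) (repT X c F \<theta> (Cod (sets_cat U) \<phi>)) (farr (repF X c) \<phi>) =
        Cmp (sets_cat V) (farr F \<phi>) (repT X c F \<theta> (Dom (sets_cat U) \<phi>))"
      using 2[of "fst \<phi>" "snd (snd \<phi>)" "app \<phi>"]
      by (simp add: Arr_sets_cat del: sets_cat_simps(5))
  qed (use 1 in \<open>simp del: fobj_repF\<close>)
qed

text \<open>If \<open>\<eta>\<close> identifies two distinct points of one set then, by naturality, it is constant on every
  set, and so it cannot tell apart the two projections to the identity of the functor
  \<open>Y \<mapsto> Y \<times> Y\<close>, realised here as the representable functor of a two-element set.\<close>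

lemma monic_nat_injective:
  fixes F :: "('u set, 'u fn, 'u set, 'u fn) func"
  assumes inf: "infinite (UNIV :: 'u set)"
    and mono: "monic_nat FinSet FinSet idF F \<eta>"
    and pq: "p \<in> A" "q \<in> A" "finite A" "app (\<eta> A) p = app (\<eta> A) q"
  shows "p = q"
proof (rule ccontr)
  assume "p \<noteq> q"
  have N: "nat_trans (sets_cat (Collect finite)) (sets_cat (Collect finite)) idF F \<eta>"
    using mono by (simp add: monic_nat_def FinSet_eq)
  \<comment> \<open>The map \<open>f\<close> below carries \<open>p\<close> to \<open>b\<close> and
    \<open>q\<close> to \<open>b'\<close>; naturality transports the collision of \<open>p\<close>
    and \<open>q\<close> along it.\<close>
  have const: "app (\<eta> B) b = app (\<eta> B) b'" if "b \<in> B" "b' \<in> B" "finite B" for B b b'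
  proof -
    define f where "f = restrict (\<lambda>x. if x = p then b else b') A"
    have f: "f \<in> A \<rightarrow>\<^sub>E B" using that by (auto simp: f_def)
    have "app (\<eta> B) (f x) = app (farr F (A, f, B)) (app (\<eta> A) x)" if "x \<in> A" for x
      using nat_trans_sets_cat_natural[OF N _ _ f] that pq \<open>finite B\<close> by (simp add: idF_def)
    from this[of p] this[of q] show ?thesis using pq \<open>p \<noteq> q\<close> by (simp add: f_def)
  qed
  define X where "X = {p, q}"
  \<comment> \<open>For finite \<open>Y\<close> the hom-set is finite and embeds in the infinite
    type \<open>'u\<close>, so the choice is then injective.\<close>
  define c where "c = (\<lambda>Y. SOME g :: ('u \<Rightarrow> 'u) \<Rightarrow> 'u. inj_on g (X \<rightarrow>\<^sub>E Y))"
  have fin: "finite (X \<rightarrow>\<^sub>E Y)" if "finite Y" for Y :: "'u set"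
    using that by (auto simp: X_def intro: finite_PiE)
  have inj: "inj_on (c Y) (X \<rightarrow>\<^sub>E Y)" if "finite Y" for Y
  proof -
    obtain B :: "'u set" where "finite B" "card B = card (X \<rightarrow>\<^sub>E Y)"
      using infinite_arbitrarily_large[OF inf] by blast
    then have "\<exists>g :: ('u \<Rightarrow> 'u) \<Rightarrow> 'u. inj_on g (X \<rightarrow>\<^sub>E Y)"
      using finite_same_card_bij[OF fin[OF that]] by (metis bij_betw_imp_inj_on)
    then show ?thesis unfolding c_def by (rule someI_ex)
  qed
  \<comment> \<open>Evaluation at a point of \<open>X = {p, q}\<close> is one of the two projections
    from pairs of elements of \<open>Y\<close> to \<open>Y\<close>.\<close>
  have T: "nat_trans FinSet FinSet (repF X c) idF (repT X c idF (\<lambda>Y f. f x))" if "x \<in> X" for x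
    unfolding FinSet_eq
  proof (rule nat_trans_repT)
    show "is_functor (sets_cat (Collect finite)) (sets_cat (Collect finite))
        (idF :: ('u set, 'u fn, 'u set, 'u fn) func)"
      using N by (simp add: nat_trans_def)
  qed (use inj fin that in \<open>auto simp: idF_def compose_def\<close>)
  \<comment> \<open>By \<open>const\<close> the two projections agree after composition with \<eta>,
    so monicity in the functor category makes them equal.\<close>
  have "repT X c idF (\<lambda>Y f. f p) Y = repT X c idF (\<lambda>Y f. f q) Y" if "finite Y" for Y
  proof -
    have "Cmp FinSet (\<eta> Y) (repT X c idF (\<lambda>Y f. f p) Y) =
        Cmp FinSet (\<eta> Y) (repT X c idF (\<lambda>Y f. f q) Y)" if "finite Y" for Y
    proof -
      have "app (\<eta> Y) (f p) = app (\<eta> Y) (f q)" if "f \<in> X \<rightarrow>\<^sub>E Y" for f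
        using that \<open>finite Y\<close> by (intro const) (auto simp: X_def)
      then show ?thesis
        using inj[OF that] unfolding FinSet_eq sets_cat_simps
        by (auto simp: repT_def compose_def fun_eq_iff)
    qed
    moreover have "p \<in> X" "q \<in> X" "Obj FinSet = Collect finite"
      by (simp_all add: X_def FinSet_eq)
    ultimately show ?thesis
      using mono T[of p] T[of q] that unfolding monic_nat_def by blast
  qed
  from this[of X] have "repT X c idF (\<lambda>Y f. f p) X = repT X c idF (\<lambda>Y f. f q) X"
    by (simp add: X_def)
  \<comment> \<open>At the identity of \<open>X\<close> the two projections return \<open>p\<close>
    and \<open>q\<close> themselves.\<close>
  moreover have "restrict (\<lambda>x. x) X \<in> X \<rightarrow>\<^sub>E X" "finite X" by (auto simp: X_def)
  ultimately have "restrict (\<lambda>x. x) X p = restrict (\<lambda>x. x) X q"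
    using app_repT[of c X X "restrict (\<lambda>x. x) X" idF] inj[of X] by metis
  with \<open>p \<noteq> q\<close> show False by (simp add: X_def)
qed

section \<open>Small sets and colimits of sets\<close>

context
  assumes GU: "grothendieck_universe TYPE('u)"
begin

section \<open>Cardinal arithmetic in a Grothendieck universe\<close>

lemma universe_infinite: "infinite (UNIV :: 'u set)"
  using GU unfolding grothendieck_universe_def
  by (metis card_of_nat finite_iff_ordLess_natLeq infinite_iff_natLeq_ordLeq ordLess_imp_ordLeq)

text \<open>Stability is regularity in the form needed for products: a disjoint union of fewer than
  the universe many sets, each small, is again small.\<close>

lemma universe_stable: "stable |UNIV :: 'u set|"
  using GU universe_infinite unfolding grothendieck_universe_def
  by (intro regularCard_stable) (simp_all add: card_of_card_order_on Field_card_of)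

lemma finite_small: "finite (A :: 'u set) \<Longrightarrow> small A"
  unfolding small_def finite_iff_ordLess_natLeq
  using GU ordLess_transitive unfolding grothendieck_universe_def by blast

lemma small_Times:
  assumes "small (A :: 'u set)" "small (B :: 'u set)"
  shows "|A \<times> B| <o |UNIV :: 'u set|"
  using stable_elim[OF universe_stable, of A "\<lambda>_. B"] assms by (simp add: small_def)

lemma pairing_exists: "\<exists>p :: 'u \<times> 'u \<Rightarrow> 'u. inj p"
proof -
  have "|(UNIV :: 'u set) \<times> (UNIV :: 'u set)| \<le>o |UNIV :: 'u set|"
    using card_of_Times_same_infinite[OF universe_infinite] ordIso_imp_ordLeq by blast
  then show ?thesis
    by (auto simp: card_of_ordLeq[symmetric])
qed

text \<open>A function is determined by its graph, a subset of \<open>A \<times> B\<close>. The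
  strong limit condition speaks of sets of elements of \<open>'u\<close>, so the graph is first
  moved into \<open>'u\<close> along an injective pairing.\<close>

lemma small_PiE:
  assumes "small (A :: 'u set)" "small (B :: 'u set)"
  shows "|A \<rightarrow>\<^sub>E B| <o |UNIV :: 'u set|"
proof -
  obtain p :: "'u \<times> 'u \<Rightarrow> 'u" where p: "inj p" using pairing_exists by blast
  let ?C = "p ` (A \<times> B)"
  have "|?C| <o |UNIV :: 'u set|"
    using small_Times[OF assms] card_of_image ordLeq_ordLess_trans by blast
  then have "|Pow ?C| <o |UNIV :: 'u set|"
    using GU by (simp add: grothendieck_universe_def)
  moreover have "|A \<rightarrow>\<^sub>E B| \<le>o |Pow ?C|"
  proof (rule card_of_ordLeqI)
    show "inj_on (\<lambda>f. p ` (\<lambda>x. (x, f x)) ` A) (A \<rightarrow>\<^sub>E B)"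
    proof (rule inj_onI)
      fix f g assume fg: "f \<in> A \<rightarrow>\<^sub>E B" "g \<in> A \<rightarrow>\<^sub>E B"
        and "p ` (\<lambda>x. (x, f x)) ` A = p ` (\<lambda>x. (x, g x)) ` A"
      then have "(\<lambda>x. (x, f x)) ` A = (\<lambda>x. (x, g x)) ` A"
        using p by (simp add: inj_image_eq_iff)
      then have "f x = g x" if "x \<in> A" for x using that by auto
      then show "f = g" using fg by (auto intro: PiE_ext)
    qed
  qed auto
  ultimately show ?thesis using ordLeq_ordLess_trans by blast
qed

lemma hom_encoding_exists:
  fixes X :: "'u set"
  assumes "small X"
  obtains c :: "'u set \<Rightarrow> ('u \<Rightarrow> 'u) \<Rightarrow> 'u"
  where "\<And>Y. small Y \<Longrightarrow> inj_on (c Y) (X \<rightarrow>\<^sub>E Y)" "\<And>Y. small Y \<Longrightarrow> small (c Y ` (X \<rightarrow>\<^sub>E Y))"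
proof -
  have "\<exists>g :: ('u \<Rightarrow> 'u) \<Rightarrow> 'u. inj_on g (X \<rightarrow>\<^sub>E Y)" if "small Y" for Y
    using ordLess_imp_ordLeq[OF small_PiE[OF assms that]] by (auto simp: card_of_ordLeq[symmetric])
  then obtain c :: "'u set \<Rightarrow> ('u \<Rightarrow> 'u) \<Rightarrow> 'u"
    where c: "\<And>Y. small Y \<Longrightarrow> inj_on (c Y) (X \<rightarrow>\<^sub>E Y)" by metis
  moreover have "small (c Y ` (X \<rightarrow>\<^sub>E Y))" if "small Y" for Y
    unfolding small_def
    using card_of_image small_PiE[OF assms that] ordLeq_ordLess_trans by blast
  ultimately show thesis by (rule that)
qed

text \<open>Two maps out of \<open>c\<close> that differ only at a point missed by all legs have the
  same composite with every leg, against the uniqueness of mediating maps.\<close>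

lemma colimit_jointly_surjective:
  assumes col: "is_colimit J SetC D c \<iota>" and s: "s \<in> (c :: 'u set)"
  shows "\<exists>j\<in>Obj J. s \<in> app (\<iota> j) ` fobj D j"
proof (rule ccontr)
  assume neg: "\<not> ?thesis"
  obtain a b :: 'u where ab: "a \<noteq> b"
    using universe_infinite by (metis (full_types) UNIV_I finite.simps finite_subset insertCI subsetI)
  let ?d = "{a, b}"
  define f where "f = (c, restrict (\<lambda>x. a) c, ?d)"
  define g where "g = (c, restrict (\<lambda>x. if x = s then b else a) c, ?d)"
  have cc: "is_cocone J SetC D c \<iota>" using col by (simp add: is_colimit_def)
  then have D: "is_functor J SetC D" and c: "small c"
    and \<iota>: "\<And>j. j \<in> Obj J \<Longrightarrow> fst (\<iota> j) = fobj D j \<and> app (\<iota> j) \<in> fobj D j \<rightarrow>\<^sub>E c \<and> small (fobj D j)"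
    and com: "\<And>u. u \<in> Arr J \<Longrightarrow> Cmp SetC (\<iota> (Cod J u)) (farr D u) = \<iota> (Dom J u)"
    by (auto simp: is_cocone_def SetC_eq homset_sets_cat)
  have J: "is_category J" using D by (simp add: is_functor_def)
  \<comment> \<open>The cocone induced by the constant map \<open>f\<close>; since no leg reaches
    \<open>s\<close>, the map \<open>g\<close> mediates it as well.\<close>
  define \<kappa> where "\<kappa> = (\<lambda>j. Cmp SetC f (\<iota> j))"
  have hom: "f \<in> homset SetC c ?d" "g \<in> homset SetC c ?d"
    using c finite_small[of ?d] by (auto simp: f_def g_def SetC_eq homset_sets_cat)
  have "is_cocone J SetC D ?d \<kappa>"
    unfolding is_cocone_def
  proof (intro conjI ballI D)
    show "?d \<in> Obj SetC" using finite_small[of ?d] by (simp add: SetC_eq)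
    show "\<kappa> j \<in> homset SetC (fobj D j) ?d" if "j \<in> Obj J" for j
      using \<iota>[OF that] finite_small[of ?d]
      by (auto simp: \<kappa>_def f_def SetC_eq homset_sets_cat compose_def)
    fix u assume u: "u \<in> Arr J"
    then have o: "Dom J u \<in> Obj J" "Cod J u \<in> Obj J"
      using J by (auto simp: is_category_def)
    have "farr D u \<in> homset SetC (fobj D (Dom J u)) (fobj D (Cod J u))"
      using D u by (simp add: is_functor_def)
    then show "Cmp SetC (\<kappa> (Cod J u)) (farr D u) = \<kappa> (Dom J u)"
      using \<iota>[OF o(1)] \<iota>[OF o(2)]
      by (auto simp: \<kappa>_def f_def SetC_eq homset_sets_cat compose_def fun_eq_iff)
  qed
  moreover have "Cmp SetC g (\<iota> j) = \<kappa> j" if "j \<in> Obj J" for j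
    using \<iota>[OF that] neg that
    by (auto simp: \<kappa>_def f_def g_def SetC_eq compose_def fun_eq_iff)
  ultimately have "f = g"
    using col hom unfolding is_colimit_def \<kappa>_def by blast
  then have "app f s = app g s" by simp
  with ab s show False by (simp add: f_def g_def)
qed

end

section \<open>A set as the colimit of its initial segments\<close>

text \<open>The order \<open>l\<close> as a category; its arrows have to be elements of \<open>'u\<close>, so the pairs in \<open>l\<close> are
  encoded by an injection \<open>p\<close>.\<close>

definition chain_cat :: "('u \<times> 'u \<Rightarrow> 'u) \<Rightarrow> 'u rel \<Rightarrow> ('u, 'u) cat" where
  "chain_cat p l =
     \<lparr>Obj = Field l, Arr = p ` l, Dom = (\<lambda>u. fst (inv p u)), Cod = (\<lambda>u. snd (inv p u)),
      Idn = (\<lambda>x. p (x, x)), Cmp = (\<lambda>v u. p (fst (inv p u), snd (inv p v)))\<rparr>"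

definition incl_arr :: "'u set \<Rightarrow> 'u set \<Rightarrow> 'u fn" where
  "incl_arr A B = (A, restrict (\<lambda>x. x) A, B)"

text \<open>The segments \<open>under l a\<close> are closed: each \<open>x\<close> lies in its own
  segment \<open>under l x\<close>, so the segments cover \<open>Field l\<close>.\<close>

definition segF :: "('u \<times> 'u \<Rightarrow> 'u) \<Rightarrow> 'u rel \<Rightarrow> ('u, 'u, 'u set, 'u fn) func" where
  "segF p l = \<lparr>fobj = under l, farr = (\<lambda>u. incl_arr (under l (fst (inv p u))) (under l (snd (inv p u))))\<rparr>"

lemma small_subset: "B \<subseteq> A \<Longrightarrow> small A \<Longrightarrow> small (B :: 'u set)"
  unfolding small_def using card_of_mono1 ordLeq_ordLess_trans by blast

context
  fixes l :: "'u rel" and p :: "'u \<times> 'u \<Rightarrow> 'u"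
  assumes l: "small_regular_cardinal l" and p: "inj p"
begin

lemma regular_cardinal_facts:
  shows "Card_order l" "regularCard l" "l <o |UNIV :: 'u set|"
    "trans l" "x \<in> Field l \<Longrightarrow> (x, x) \<in> l" "Well_order l"
  using l
  by (auto simp: small_regular_cardinal_def order_on_defs card_order_on_def refl_on_def)

lemma chain_simps [simp]:
  "Obj (chain_cat p l) = Field l"
  "Arr (chain_cat p l) = p ` l"
  "Dom (chain_cat p l) (p z) = fst z"
  "Cod (chain_cat p l) (p z) = snd z"
  "Idn (chain_cat p l) x = p (x, x)"
  "Cmp (chain_cat p l) (p z) (p w) = p (fst w, snd z)"
  "fobj (segF p l) a = under l a"
  "farr (segF p l) (p z) = incl_arr (under l (fst z)) (under l (snd z))"
  using p by (simp_all add: chain_cat_def segF_def inv_f_f)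

section \<open>The well-order of a regular cardinal as a filtered category, and the diagram of its
  segments\<close>

lemma is_category_chain: "is_category (chain_cat p l)"
  using regular_cardinal_facts(5) transD[OF regular_cardinal_facts(4)]
  by (auto simp: is_category_def homset_def image_iff FieldI1 FieldI2 inj_eq[OF p])

lemma small_Field: "small (Field l)"
  using regular_cardinal_facts(1,3) card_of_Field_ordIso ordIso_ordLess_trans unfolding small_def by blast

lemma small_under: "small (under l a)"
  by (rule small_subset[OF _ small_Field]) (rule under_Field)

lemma small_category_chain:
  assumes "grothendieck_universe TYPE('u)"
  shows "small_category (chain_cat p l)"
proof -
  have "l \<subseteq> Field l \<times> Field l" by (auto intro: FieldI1 FieldI2)
  then have "|p ` l| <o |UNIV :: 'u set|"
    by (rule ordLeq_ordLess_trans[OF ordLeq_transitive[OF card_of_image card_of_mono1]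
          small_Times[OF assms small_Field small_Field]])
  then show ?thesis
    unfolding small_category_def using is_category_chain small_Field by (simp add: small_def)
qed

text \<open>In the category of an order any two parallel arrows are equal, so an upper bound of the
  objects of a diagram is already a cocone. Regularity supplies the bound.\<close>

lemma filtered_chain: "filtered l (chain_cat p l)"
  unfolding filtered_def
proof (intro conjI allI impI is_category_chain)
  fix K :: "('u, 'u) cat" and D :: "('u, 'u, 'u, 'u) func"
  assume D: "is_functor K (chain_cat p l) D" and less: "|Arr K| <o l"
  have K: "is_category K" using D by (simp add: is_functor_def)
  have DO: "fobj D ` Obj K \<subseteq> Field l" using D by (auto simp: is_functor_def)
  \<comment> \<open>Each object is the domain of its identity, so the bound on the arrows also
    bounds the objects.\<close>
  have "Obj K \<subseteq> Dom K ` Arr K"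
    using K by (force simp: is_category_def homset_def)
  then have "fobj D ` Obj K \<subseteq> (fobj D \<circ> Dom K) ` Arr K" by auto
  then have "|fobj D ` Obj K| <o l"
    by (rule ordLeq_ordLess_trans[OF ordLeq_transitive[OF card_of_mono1 card_of_image] less])
  \<comment> \<open>In a regular cardinal a cofinal set has full cardinality. Failure of cofinality
    gives a \<open>c\<close> with no object of the image strictly above it, and totality puts them
    all below \<open>c\<close>.\<close>
  then have "\<not> cofinal (fobj D ` Obj K) l"
    using regular_cardinal_facts(2) DO not_ordLess_ordIso unfolding regularCard_def by blast
  then obtain c where c: "c \<in> Field l" "\<And>k. k \<in> Obj K \<Longrightarrow> \<not> (c \<noteq> fobj D k \<and> (c, fobj D k) \<in> l)"
    unfolding cofinal_def by blast
  have bound: "(fobj D k, c) \<in> l" if "k \<in> Obj K" for k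
    using c(2)[OF that] c(1) DO that regular_cardinal_facts(5,6)
    by (auto simp: order_on_defs total_on_def image_subset_iff) (metis)
  have "is_cocone K (chain_cat p l) D c (\<lambda>k. p (fobj D k, c))"
    unfolding is_cocone_def
  proof (intro conjI ballI D)
    fix u assume u: "u \<in> Arr K"
    then have "farr D u \<in> homset (chain_cat p l) (fobj D (Dom K u)) (fobj D (Cod K u))"
      using D by (simp add: is_functor_def)
    then obtain z where "farr D u = p z" "fst z = fobj D (Dom K u)"
      by (auto simp: homset_def)
    then show "Cmp (chain_cat p l) (p (fobj D (Cod K u), c)) (farr D u) = p (fobj D (Dom K u), c)"
      by simp
  qed (use c bound in \<open>auto simp: homset_def\<close>)
  then show "\<exists>c \<iota>. is_cocone K (chain_cat p l) D c \<iota>" by blast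
qed

lemma is_functor_seg: "is_functor (chain_cat p l) SetC (segF p l)"
  unfolding is_functor_def SetC_eq using transD[OF regular_cardinal_facts(4)]
  by (auto simp: is_category_chain is_category_sets_cat small_under[unfolded under_def]
      homset_sets_cat incl_arr_def under_def compose_def fun_eq_iff)

text \<open>Every \<open>x\<close> lies in its own segment, so the mediating map can only send
  \<open>x\<close> to the value at \<open>x\<close> of the leg at index \<open>x\<close>;
  compatibility of the legs shows that this works.\<close>

lemma colimit_seg:
  "is_colimit (chain_cat p l) SetC (segF p l) (Field l) (\<lambda>a. incl_arr (under l a) (Field l))"
  unfolding is_colimit_def
proof (intro conjI allI impI)
  show "is_cocone (chain_cat p l) SetC (segF p l) (Field l) (\<lambda>a. incl_arr (under l a) (Field l))"
    unfolding is_cocone_def using is_functor_seg transD[OF regular_cardinal_facts(4)]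
    by (auto simp: SetC_eq small_under[unfolded under_def] small_Field homset_sets_cat
        incl_arr_def under_def compose_def fun_eq_iff intro: FieldI1)
next
  fix d \<kappa> assume "is_cocone (chain_cat p l) SetC (segF p l) d \<kappa>"
  then have d: "small d"
    and \<kappa>: "\<And>a. a \<in> Field l \<Longrightarrow> fst (\<kappa> a) = under l a \<and> app (\<kappa> a) \<in> under l a \<rightarrow>\<^sub>E d \<and> snd (snd (\<kappa> a)) = d"
    and com: "\<And>z. z \<in> l \<Longrightarrow> Cmp SetC (\<kappa> (snd z)) (incl_arr (under l (fst z)) (under l (snd z))) = \<kappa> (fst z)"
    unfolding is_cocone_def by (auto simp: SetC_eq homset_sets_cat)
  \<comment> \<open>All legs whose segment contains \<open>x\<close> take the same value there,
    namely that of the leg at \<open>x\<close>.\<close>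
  have com': "app (\<kappa> a) x = app (\<kappa> x) x" if "(x, a) \<in> l" for x a
  proof -
    have "x \<in> under l x" using that regular_cardinal_facts(5) by (auto simp: under_def intro: FieldI1)
    then show ?thesis
      using arg_cong[OF com[OF that], of "\<lambda>\<phi>. app \<phi> x"]
      by (simp add: SetC_eq incl_arr_def compose_def)
  qed
  define h where "h = (Field l, restrict (\<lambda>x. app (\<kappa> x) x) (Field l), d)"
  have selfu: "x \<in> under l x" if "x \<in> Field l" for x
    using that regular_cardinal_facts(5) by (auto simp: under_def)
  show "\<exists>!h. h \<in> homset SetC (Field l) d \<and>
      (\<forall>a\<in>Obj (chain_cat p l). Cmp SetC h (incl_arr (under l a) (Field l)) = \<kappa> a)"
  proof (rule ex1I[of _ h])
    show "h \<in> homset SetC (Field l) d \<and>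
      (\<forall>a\<in>Obj (chain_cat p l). Cmp SetC h (incl_arr (under l a) (Field l)) = \<kappa> a)"
    proof (intro conjI ballI)
      have "app (\<kappa> x) x \<in> d" if "x \<in> Field l" for x
        using PiE_mem[of "app (\<kappa> x)" "under l x" "\<lambda>_. d" x] \<kappa>[OF that] selfu[OF that] by simp
      then show "h \<in> homset SetC (Field l) d"
        using d small_Field by (auto simp: h_def SetC_eq homset_sets_cat)
      fix a assume "a \<in> Obj (chain_cat p l)"
      then have a: "a \<in> Field l" by simp
      have "compose (under l a) (restrict (\<lambda>x. app (\<kappa> x) x) (Field l))
          (restrict (\<lambda>x. x) (under l a)) = app (\<kappa> a)"
        using \<kappa>[OF a] com'[of _ a] PiE_arb[of "app (\<kappa> a)" "under l a" "\<lambda>_. d"]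
        by (auto simp: compose_def fun_eq_iff under_def intro: FieldI1)
      then show "Cmp SetC h (incl_arr (under l a) (Field l)) = \<kappa> a"
        using \<kappa>[OF a] by (auto simp: h_def SetC_eq incl_arr_def prod_eq_iff)
    qed
  next
    fix h' assume h': "h' \<in> homset SetC (Field l) d \<and>
      (\<forall>a\<in>Obj (chain_cat p l). Cmp SetC h' (incl_arr (under l a) (Field l)) = \<kappa> a)"
    then have 1: "fst h' = Field l" "snd (snd h') = d" "app h' \<in> Field l \<rightarrow>\<^sub>E d"
      by (auto simp: SetC_eq homset_sets_cat)
    have "app h' x = app (\<kappa> x) x" if "x \<in> Field l" for x
    proof -
      have "Cmp SetC h' (incl_arr (under l x) (Field l)) = \<kappa> x" using h' that by simp
      from arg_cong[OF this, of "\<lambda>\<phi>. app \<phi> x"] show ?thesis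
        using selfu[OF that] by (simp add: SetC_eq incl_arr_def compose_def)
    qed
    then have "app h' = restrict (\<lambda>x. app (\<kappa> x) x) (Field l)"
      using PiE_arb[OF 1(3)] by (auto simp: fun_eq_iff)
    then show "h' = h" using 1 by (simp add: h_def prod_eq_iff)
  qed
qed

end

section \<open>The pushforward has no rank\<close>

text \<open>The complements of the segments form a chain of sets, nonempty because an infinite
  cardinal has no last element. They generate a proper filter, and any ultrafilter refining it
  works.\<close>

lemma ultrafilter_avoiding_segments_exists:
  assumes "Card_order l" "infinite (Field l)"
  obtains F where "F \<noteq> bot" "\<And>P. eventually P F \<or> eventually (\<lambda>x. \<not> P x) F"
    "eventually (\<lambda>x. x \<in> Field l) F" "\<And>a. a \<in> Field l \<Longrightarrow> eventually (\<lambda>x. x \<notin> under l a) F"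
proof -
  have W: "trans l" "antisym l" "total_on (Field l) l" "\<And>x. x \<in> Field l \<Longrightarrow> (x, x) \<in> l"
    using assms(1) by (auto simp: order_on_defs card_order_on_def refl_on_def)
  \<comment> \<open>The filters of \<open>B\<close> are linearly ordered since \<open>l\<close> is
    total, so being eventual in \<open>Inf B\<close> means containing a single tail.\<close>
  define B where "B = (\<lambda>a. principal {x \<in> Field l. x \<notin> under l a}) ` Field l"
  have ev: "eventually P (Inf B) \<longleftrightarrow> (\<exists>G\<in>B. eventually P G)" for P
  proof (rule eventually_Inf_base)
    show "B \<noteq> {}" using assms(2) by (auto simp: B_def)
    have *: "principal {x \<in> Field l. x \<notin> under l b} \<le> principal {x \<in> Field l. x \<notin> under l a}"
      if "(a, b) \<in> l" for a b
      using that transD[OF W(1)] by (auto simp: under_def)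
    fix G H assume "G \<in> B" "H \<in> B"
    then obtain a b where ab: "a \<in> Field l" "b \<in> Field l"
      "G = principal {x \<in> Field l. x \<notin> under l a}" "H = principal {x \<in> Field l. x \<notin> under l b}"
      by (auto simp: B_def)
    have "(a, b) \<in> l \<or> (b, a) \<in> l"
      using W(3,4) ab(1,2) by (metis total_on_def)
    then have "G \<le> H \<or> H \<le> G" using *[of a b] *[of b a] ab by blast
    then show "\<exists>x\<in>B. x \<le> inf G H" using \<open>G \<in> B\<close> \<open>H \<in> B\<close> by (auto simp: le_infI)
  qed
  have "Inf B \<noteq> bot"
  proof
    assume "Inf B = bot"
    then have "eventually (\<lambda>x. False) (Inf B)" by simp
    then obtain a where a: "a \<in> Field l" "{x \<in> Field l. x \<notin> under l a} = {}"
      unfolding ev by (auto simp: B_def eventually_principal)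
    obtain b where "b \<in> Field l" "a \<noteq> b" "(a, b) \<in> l"
      using infinite_Card_order_limit[OF assms a(1)] by blast
    with a(2) show False using W(2) by (auto simp: under_def dest: antisymD)
  qed
  then obtain F where F: "F \<le> Inf B" "F \<noteq> bot" "\<And>P. eventually P F \<or> eventually (\<lambda>x. \<not> P x) F"
    by (rule exists_ultrafilter_le) blast
  have tail: "eventually (\<lambda>x. x \<in> Field l \<and> x \<notin> under l a) F" if "a \<in> Field l" for a
  proof (rule filter_leD[OF F(1)])
    have "principal {x \<in> Field l. x \<notin> under l a} \<in> B" using that by (simp add: B_def)
    then show "eventually (\<lambda>x. x \<in> Field l \<and> x \<notin> under l a) (Inf B)"
      unfolding ev by (rule bexI[rotated]) (simp add: eventually_principal)
  qed
  obtain a where "a \<in> Field l" using assms(2) by fastforce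
  from tail[OF this] have "eventually (\<lambda>x. x \<in> Field l) F" by (rule eventually_mono) auto
  moreover have "eventually (\<lambda>x. x \<notin> under l a) F" if "a \<in> Field l" for a
    using tail[OF that] by (rule eventually_mono) auto
  ultimately show thesis
    using F(2,3) by (intro that[of F]) blast+
qed

theorem theorem3p14:
  fixes T S :: "('u set, 'u fn) monad"
    and \<epsilon> :: "'u set \<Rightarrow> 'u fn"
  assumes "grothendieck_universe TYPE('u)"
    and "consistent_monad FinSet T"
    and "is_pushforward FinSet SetC incl T S \<epsilon>"
  shows "\<not> has_rank S"
proof
  assume "has_rank S"
  then obtain l :: "'u rel" where l: "small_regular_cardinal l"
    and acc: "accessible_functor l SetC SetC (mfun S)"
    by (auto simp: has_rank_def)
  note GU = assms(1)
  note inf = universe_infinite[OF GU]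
  have lc: "Card_order l" "infinite (Field l)"
    using l by (simp_all add: small_regular_cardinal_def)
  define X where "X = Field l"
  obtain p :: "'u \<times> 'u \<Rightarrow> 'u" where p: "inj p" using pairing_exists[OF GU] by blast
  have X: "small X" unfolding X_def by (rule small_Field[OF l p])
  obtain F where F: "F \<noteq> bot" "\<And>P. eventually P F \<or> eventually (\<lambda>x. \<not> P x) F"
    and FX: "eventually (\<lambda>x. x \<in> X) F"
    and Fu: "\<And>a. a \<in> X \<Longrightarrow> eventually (\<lambda>x. x \<notin> under l a) F"
    using ultrafilter_avoiding_segments_exists[OF lc] unfolding X_def by blast
  obtain c :: "'u set \<Rightarrow> ('u \<Rightarrow> 'u) \<Rightarrow> 'u"
    where c: "\<And>Y. small Y \<Longrightarrow> inj_on (c Y) (X \<rightarrow>\<^sub>E Y)" "\<And>Y. small Y \<Longrightarrow> small (c Y ` (X \<rightarrow>\<^sub>E Y))"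
    using hom_encoding_exists[OF GU X] by metis

  \<comment> \<open>Limits along the ultrafilter and the universal property of the Kan
    extension\<close>
  have monic: "monic_nat FinSet FinSet idF (mfun T) (munit T)"
    using assms(2) by (simp add: consistent_monad_def)
  have \<eta>: "nat_trans (sets_cat (Collect finite)) (sets_cat (Collect finite)) idF (mfun T) (munit T)"
    using monic by (simp add: monic_nat_def FinSet_eq)
  have kan: "is_right_kan FinSet SetC SetC incl (incl \<circ>F mfun T) (mfun S) \<epsilon>"
    using assms(3) by (simp add: is_pushforward_def)
  \<comment> \<open>\<open>incl\<close> acts as the identity on objects and arrows, so restricting
    \<open>S\<close> to finite sets or viewing \<open>T\<close> in sets leaves the underlying
    functor data unchanged.\<close>
  have incl_comp: "incl \<circ>F G = G" "G \<circ>F incl = G" for G :: "('u set, 'u fn, 'u set, 'u fn) func"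
    by (simp_all add: incl_def compF_def)
  have \<epsilon>: "nat_trans (sets_cat (Collect finite)) (sets_cat (Collect small)) (mfun S) (mfun T) \<epsilon>"
    using kan by (simp add: is_right_kan_def incl_comp SetC_eq FinSet_eq)

  define \<theta> where "\<theta> = (\<lambda>Y f. app (munit T Y) (ultra_lim F f))"
  define \<gamma> where "\<gamma> = repT X c (mfun T) \<theta>"
  have lim: "ultra_lim F f \<in> Y" "eventually (\<lambda>x. f x = ultra_lim F f) F"
    if "finite Y" "f \<in> X \<rightarrow>\<^sub>E Y" for f Y
  proof -
    have "eventually (\<lambda>x. f x \<in> Y) F"
      using FX by eventually_elim (use that(2) in auto)
    then show "ultra_lim F f \<in> Y" "eventually (\<lambda>x. f x = ultra_lim F f) F"
      using ultra_lim_finite[OF F that(1)] by blast+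
  qed
  have \<gamma>: "nat_trans (sets_cat (Collect finite)) (sets_cat (Collect small)) (repF X c) (mfun T) \<gamma>"
    unfolding \<gamma>_def
  proof (rule nat_trans_repT)
    show "is_functor (sets_cat (Collect finite)) (sets_cat (Collect small)) (mfun T)"
      using \<epsilon> by (simp add: nat_trans_def)
    show "\<theta> Y f \<in> fobj (mfun T) Y" if "Y \<in> Collect finite" "f \<in> X \<rightarrow>\<^sub>E Y" for Y f
      unfolding \<theta>_def using nat_trans_sets_cat_in(2)[OF \<eta> that(1)] lim(1)[of Y f] that
      by (auto simp: idF_def)
    fix A B :: "'u set" and f g
    assume A: "A \<in> Collect finite" and B: "B \<in> Collect finite"
      and f: "f \<in> X \<rightarrow>\<^sub>E A" and g: "g \<in> A \<rightarrow>\<^sub>E B"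
    have fA: "ultra_lim F f \<in> A" and ev: "eventually (\<lambda>x. f x = ultra_lim F f) F"
      using lim[of A f] A f by simp_all
    \<comment> \<open>Naturality of \<open>\<theta>\<close> rests on this: any map \<open>g\<close>
      between finite sets preserves limits along \<open>F\<close>, since \<open>f\<close> is
      eventually equal to its limit.\<close>
    from ev FX have "eventually (\<lambda>x. compose X g f x = g (ultra_lim F f)) F"
      by eventually_elim (simp add: compose_def)
    then have "ultra_lim F (compose X g f) = g (ultra_lim F f)"
      by (rule ultra_lim_eqI[OF F(1)])
    then show "\<theta> B (compose X g f) = app (farr (mfun T) (A, g, B)) (\<theta> A f)"
      using nat_trans_sets_cat_natural[OF \<eta> A B g] fA by (simp add: \<theta>_def idF_def)
  qed (use c finite_small[OF GU] in simp_all)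
  have R: "is_functor SetC SetC (repF X c)"
    unfolding SetC_eq by (rule is_functor_repF) (use c in simp_all)
  have "nat_trans FinSet SetC (repF X c \<circ>F incl) (incl \<circ>F mfun T) \<gamma>"
    using \<gamma> by (simp add: incl_comp SetC_eq FinSet_eq)
  \<comment> \<open>The Kan extension turns \<open>\<gamma>\<close>, defined on finite sets only,
    into a transformation from the representable of \<open>X\<close> to \<open>S\<close> on all
    small sets.\<close>
  then obtain \<alpha> where \<alpha>: "nat_trans SetC SetC (repF X c) (mfun S) \<alpha>"
    and \<epsilon>\<alpha>: "\<And>Y. Y \<in> Obj FinSet \<Longrightarrow> Cmp SetC (\<epsilon> Y) (\<alpha> (fobj incl Y)) = \<gamma> Y"
    using kan R unfolding is_right_kan_def by metis
  have \<alpha>': "nat_trans (sets_cat (Collect small)) (sets_cat (Collect small)) (repF X c) (mfun S) \<alpha>"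
    using \<alpha> by (simp add: SetC_eq)

  \<comment> \<open>The Yoneda element of \<open>S\<close> at \<open>X\<close>\<close>
  define i where "i = restrict (\<lambda>x. x) X"
  have i: "i \<in> X \<rightarrow>\<^sub>E X" by (simp add: i_def)
  define s where "s = app (\<alpha> X) (c X i)"
  have ci: "c X i \<in> fobj (repF X c) X" using i by simp
  have s: "s \<in> fobj (mfun S) X"
    unfolding s_def using nat_trans_sets_cat_in(2)[OF \<alpha>', of X] X ci by (auto simp del: fobj_repF)
  \<comment> \<open>The code of \<open>f\<close> is the image under \<open>f\<close> of the code of
    the identity, so naturality of \<open>\<alpha>\<close> identifies the image of \<open>s\<close>
    under \<open>f\<close> with \<open>\<alpha>\<close> at \<open>f\<close>; the counit then
    recovers \<open>\<gamma>\<close>.\<close>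
  have key: "app (\<epsilon> Y) (app (farr (mfun S) (X, f, Y)) s) = app (munit T Y) (ultra_lim F f)"
    if Y: "finite Y" and f: "f \<in> X \<rightarrow>\<^sub>E Y" for Y f
  proof -
    have Ys: "small Y" by (rule finite_small[OF GU Y])
    have "app (farr (mfun S) (X, f, Y)) s = app (\<alpha> Y) (app (farr (repF X c) (X, f, Y)) (c X i))"
      unfolding s_def using nat_trans_sets_cat_natural[OF \<alpha>' _ _ f ci] X Ys by simp
    also have "app (farr (repF X c) (X, f, Y)) (c X i) = c Y f"
      using app_farr_repF[where c = c, OF c(1)[OF X] i] f
      by (simp add: i_def compose_restrict_id_right)
    finally have 1: "app (farr (mfun S) (X, f, Y)) s = app (\<alpha> Y) (c Y f)" .
    have eq: "Cmp (sets_cat (Collect small)) (\<epsilon> Y) (\<alpha> Y) = \<gamma> Y"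
      using \<epsilon>\<alpha>[of Y] Y by (simp add: FinSet_eq SetC_eq incl_def del: sets_cat_simps(5))
    have dom: "c Y f \<in> fst (\<alpha> Y)"
      using nat_trans_sets_cat_in(1)[OF \<alpha>', of Y] Ys f by simp
    have "app (\<epsilon> Y) (app (\<alpha> Y) (c Y f)) = app (\<gamma> Y) (c Y f)"
      using arg_cong[OF eq, of "\<lambda>\<phi>. app \<phi> (c Y f)"] unfolding app_Cmp[OF dom] .
    also have "\<dots> = \<theta> Y f"
      unfolding \<gamma>_def by (rule app_repT[where c = c, OF c(1)[OF Ys] f])
    finally show ?thesis using 1 by (simp add: \<theta>_def)
  qed

  \<comment> \<open>The contradiction with accessibility\<close>
  have SF: "is_functor (sets_cat (Collect small)) (sets_cat (Collect small)) (mfun S)"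
    using acc by (simp add: accessible_functor_def SetC_eq)
  have "is_colimit (chain_cat p l) SetC (mfun S \<circ>F segF p l) (fobj (mfun S) X)
      (\<lambda>a. farr (mfun S) (incl_arr (under l a) X))"
    using acc small_category_chain[OF l p GU] filtered_chain[OF l p] colimit_seg[OF l p]
    unfolding accessible_functor_def X_def by blast
  \<comment> \<open>Since the functor of \<open>S\<close> preserves the colimit of the segments,
    \<open>s\<close> is the image of some \<open>t\<close> over a single segment
    \<open>under l a\<close>.\<close>
  from colimit_jointly_surjective[OF GU this s]
  obtain a t where a: "a \<in> X" and t: "t \<in> fobj (mfun S) (under l a)"
    and st: "s = app (farr (mfun S) (incl_arr (under l a) X)) t"
    by (auto simp: chain_simps[OF l p] compF_def X_def)
  obtain y z :: 'u where yz: "y \<noteq> z"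
    using inf by (metis (full_types) UNIV_I finite.simps finite_subset insertCI subsetI)
  \<comment> \<open>Both maps are \<open>y\<close> on the segment, but \<open>f\<close> is
    \<open>z\<close> off it, where \<open>F\<close> lives. Their images at \<open>s\<close> agree
    because \<open>s\<close> comes from the segment.\<close>
  define f where "f = restrict (\<lambda>x. if x \<in> under l a then y else z) X"
  define g where "g = restrict (\<lambda>x. y) X"
  define j where "j = restrict (\<lambda>x. x) (under l a)"
  have uX: "under l a \<subseteq> X" unfolding X_def by (rule under_Field)
  have fg: "f \<in> X \<rightarrow>\<^sub>E {y, z}" "g \<in> X \<rightarrow>\<^sub>E {y, z}" and j: "j \<in> under l a \<rightarrow>\<^sub>E X"
    using uX by (auto simp: f_def g_def j_def)
  have sm: "under l a \<in> Collect small" "X \<in> Collect small" "{y, z} \<in> Collect small"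
    using X small_under[OF l p] finite_small[OF GU, of "{y, z}"] by simp_all
  have comp: "compose (under l a) f j = compose (under l a) g j"
    using uX by (auto simp: f_def g_def j_def compose_def fun_eq_iff)
  have st': "s = app (farr (mfun S) (under l a, j, X)) t"
    using st by (simp add: incl_arr_def j_def)
  have "app (farr (mfun S) (X, f, {y, z})) s = app (farr (mfun S) (X, g, {y, z})) s"
    using functor_sets_cat_comp[OF SF sm j fg(1) t] functor_sets_cat_comp[OF SF sm j fg(2) t]
    unfolding st' comp by simp
  then have eq: "app (munit T {y, z}) (ultra_lim F f) = app (munit T {y, z}) (ultra_lim F g)"
    using key[OF _ fg(1)] key[OF _ fg(2)] by simp
  have "eventually (\<lambda>x. f x = z) F"
    using FX Fu[OF a] by eventually_elim (simp add: f_def)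
  then have "ultra_lim F f = z" by (rule ultra_lim_eqI[OF F(1)])
  moreover have "eventually (\<lambda>x. g x = y) F"
    using FX by eventually_elim (simp add: g_def)
  then have "ultra_lim F g = y" by (rule ultra_lim_eqI[OF F(1)])
  \<comment> \<open>By \<open>key\<close> the unit identifies the two limits, and a monic unit is
    injective on the finite set \<open>{y, z}\<close>.\<close>
  ultimately have "z = y"
    using eq monic_nat_injective[OF inf monic, of z "{y, z}" y] by simp
  with yz show False by simp
qed

end
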